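(* Let $k\geq2$ and let $\tau\in S_k(312)$ have normal form $\tau=\tau^{(0)}m_0\tau^{(1)}m_1\cdots\tau^{(r)}m_r$, with prefixes $\Theta^{(j)}$ and suffixes $\Theta^{<j>}$. Write $F_w=F_w(x,q)$. (i) If $\tau^{(0)}=\emptyset$, then $$F_\tau=1+xq+x(F_{\tau}-1)+xq(F_{\Theta^{<1>}}-1)+x\sum_{j=1}^{r}(F_{\Theta^{(j)}}-F_{\Theta^{(j-1)}})(F_{\Theta^{<j>}}-1).$$ (ii) If $\tau^{(0)}\neq\emptyset$, then \begin{align*} F_\tau&=1+xq+x(F_{\tau^{(0)}}-1)\delta_{r=0}+x(F_{\tau}-1)\delta_{r\geq1}+xq(F_\tau-1)\\ &\quad+x\sum_{j=2}^{r}(F_{\Theta^{(j)}}-F_{\Theta^{(j-1)}})(F_{\Theta^{<j>}}-1)\\ &\quad+x(F_{\Theta^{(1)}}-F_{\tau^{(0)}})(F_{\Theta^{<1>}}-1)\delta_{r\geq1}+x(F_{\tau^{(0)}}-1)(F_{\tau}-1), \end{align*} where $\delta_\chi$ is $1$ if condition $\chi$ holds and $0$ otherwise.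
   Context: $S_n$ is the set of permutations of $[n]$; pattern containment/avoidance is the usual one, and $S_n(T)$ is the set of permutations in $S_n$ avoiding all patterns in $T$. For $\sigma\in S_n$, $L_n(\sigma)$ is the length of a longest increasing subsequence of $\sigma$ (with $L_0=0$ for the empty permutation). For $\tau\in S_k(312)$, $k\geq1$, define $F_\tau(x,q)=\sum_{n\geq0}\sum_{\sigma\in S_n(312,\tau)}x^nq^{L_n(\sigma)}$ (so $F_1\equiv1$). For a sequence $w$ of distinct integers, $F_w:=F_v$ where $v$ is the reduced form of $w$ (the permutation with the same relative order), and $F_\emptyset:=0$. Normal form: if $m_0=1<m_1<\dots<m_r$ are the right-to-left minima of $\tau$ (entries smaller than all entries to their right), listed left to right, then $\tau=\tau^{(0)}m_0\tau^{(1)}m_1\cdots\tau^{(r)}m_r$ with $m_0<\tau^{(0)}<m_1<\tau^{(1)}<\cdots<m_r<\tau^{(r)}$ (each block possibly empty; $A<B$ means every entry of $A$ is smaller than every entry of $B$). Prefix: $\Theta^{(j)}=\tau^{(0)}m_0\cdots\tau^{(j)}m_j$ for $0\le j\le r$, $\Theta^{(-1)}=\emptyset$. Suffix: $\Theta^{<j>}$ is the reduced form of $\tau^{(j)}m_j\cdots\tau^{(r)}m_r$. *)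

theory Defs
  imports
    "HOL-Library.Sublist"
    "HOL-Combinatorics.Multiset_Permutations"
    "HOL-Computational_Algebra.Polynomial"
    "HOL-Computational_Algebra.Formal_Power_Series"
begin

text \<open>
  A permutation of \<open>{1..n}\<close> is its one-line notation, an element of
  \<open>permutations_of_set {1..n} :: nat list set\<close>.
\<close>

definition same_order :: "'a::linorder list \<Rightarrow> 'b::linorder list \<Rightarrow> bool" where
  "same_order u v \<longleftrightarrow> length u = length v \<and>
     (\<forall>i<length u. \<forall>j<length u. u ! i < u ! j \<longleftrightarrow> v ! i < v ! j)"

definition contains :: "'a::linorder list \<Rightarrow> 'b::linorder list \<Rightarrow> bool" where
  "contains \<sigma> \<pi> \<longleftrightarrow> (\<exists>s. subseq s \<sigma> \<and> same_order s \<pi>)"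

definition Av :: "nat \<Rightarrow> nat list set \<Rightarrow> nat list set" where
  "Av n T = {\<sigma> \<in> permutations_of_set {1..n}. \<forall>\<pi>\<in>T. \<not> contains \<sigma> \<pi>}"

definition lis :: "'a::linorder list \<Rightarrow> nat" where
  "lis \<sigma> = Max (length ` {s. subseq s \<sigma> \<and> sorted_wrt (<) s})"

text \<open>
  The reduced form of a word with distinct entries: each entry is replaced by its rank.
\<close>

definition reduced :: "'a::linorder list \<Rightarrow> nat list" where
  "reduced w = map (\<lambda>a. card {b \<in> set w. b \<le> a}) w"

text \<open>
  Since only finitely many permutations contribute to each power of \<open>x\<close>, the generating
  function lives in \<open>\<int>[q][[x]]\<close>.
\<close>

abbreviation var_x :: "int poly fps" where
  "var_x \<equiv> fps_X"

abbreviation var_q :: "int poly fps" where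
  "var_q \<equiv> fps_const (monom 1 1)"

definition perm_gf :: "nat list \<Rightarrow> int poly fps" where
  "perm_gf \<tau> = Abs_fps (\<lambda>n. \<Sum>\<sigma>\<in>Av n {[3, 1, 2], \<tau>}. monom 1 (lis \<sigma>))"

definition F :: "'a::linorder list \<Rightarrow> int poly fps" where
  "F w = (if w = [] then 0 else perm_gf (reduced w))"

fun rl_minima :: "'a::linorder list \<Rightarrow> 'a list" where
  "rl_minima [] = []"
| "rl_minima (a # w) = (if \<forall>b\<in>set w. a < b then a # rl_minima w else rl_minima w)"

text \<open>
  \<open>blocks m t i j\<close> is \<open>\<tau>\<^sup>(\<^sup>i\<^sup>) m\<^sub>i \<dots> \<tau>\<^sup>(\<^sup>j\<^sup>) m\<^sub>j\<close>, where \<open>t l\<close> stands for \<open>\<tau>\<^sup>(\<^sup>l\<^sup>)\<close>.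
\<close>

definition blocks :: "(nat \<Rightarrow> 'a) \<Rightarrow> (nat \<Rightarrow> 'a list) \<Rightarrow> nat \<Rightarrow> nat \<Rightarrow> 'a list" where
  "blocks m t i j = concat (map (\<lambda>l. t l @ [m l]) [i..<Suc j])"

definition normal_form ::
    "nat list \<Rightarrow> nat \<Rightarrow> (nat \<Rightarrow> nat) \<Rightarrow> (nat \<Rightarrow> nat list) \<Rightarrow> bool" where
  "normal_form \<tau> r m t \<longleftrightarrow>
     rl_minima \<tau> = map m [0..<Suc r] \<and>
     m 0 = 1 \<and> (\<forall>j<r. m j < m (Suc j)) \<and>
     \<tau> = blocks m t 0 r \<and>
     (\<forall>j\<le>r. \<forall>a\<in>set (t j). m j < a) \<and>
     (\<forall>j<r. \<forall>a\<in>set (t j). a < m (Suc j))"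

definition Theta_prefix :: "(nat \<Rightarrow> nat) \<Rightarrow> (nat \<Rightarrow> nat list) \<Rightarrow> nat \<Rightarrow> nat list" where
  "Theta_prefix m t j = blocks m t 0 j"

definition Theta_suffix :: "nat \<Rightarrow> (nat \<Rightarrow> nat) \<Rightarrow> (nat \<Rightarrow> nat list) \<Rightarrow> nat \<Rightarrow> nat list" where
  "Theta_suffix r m t j = reduced (blocks m t j r)"

text \<open>\<open>F\<close> agrees with \<open>perm_gf\<close> on permutations.\<close>

lemma reduced_permutation:
  assumes "\<tau> \<in> permutations_of_set {1..k}"
  shows "reduced \<tau> = \<tau>"
proof -
  have s: "set \<tau> = {1..k}" using assms by (simp add: permutations_of_set_def)
  have "card {b \<in> set \<tau>. b \<le> a} = a" if "a \<in> set \<tau>" for a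
  proof -
    have "{b \<in> set \<tau>. b \<le> a} = {1..a}" using that s by auto
    then show ?thesis by simp
  qed
  then show ?thesis by (simp add: reduced_def map_idI)
qed

lemma F_permutation:
  assumes "\<tau> \<in> permutations_of_set {1..k}" "k \<ge> 1"
  shows "F \<tau> = perm_gf \<tau>"
proof -
  have "set \<tau> = {1..k}" using assms(1) by (simp add: permutations_of_set_def)
  then have "\<tau> \<noteq> []" using assms(2) by auto
  then show ?thesis using assms(1) by (simp add: F_def reduced_permutation)
qed

lemma same_order_reduced:
  assumes "distinct w"
  shows "same_order (reduced w) w"
proof -
  have "card {b \<in> set w. b \<le> a} < card {b \<in> set w. b \<le> c} \<longleftrightarrow> a < c"
    if "a \<in> set w" "c \<in> set w" for a c
  proof (cases "a < c")
    case True
    then have "{b \<in> set w. b \<le> a} \<subseteq> {b \<in> set w. b \<le> c}" by auto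
    moreover have "c \<in> {b \<in> set w. b \<le> c}" "c \<notin> {b \<in> set w. b \<le> a}"
      using that True by auto
    ultimately have "{b \<in> set w. b \<le> a} \<subset> {b \<in> set w. b \<le> c}" by blast
    then show ?thesis using True by (simp add: psubset_card_mono)
  next
    case False
    then have "{b \<in> set w. b \<le> c} \<subseteq> {b \<in> set w. b \<le> a}" by auto
    then have "card {b \<in> set w. b \<le> c} \<le> card {b \<in> set w. b \<le> a}" by (simp add: card_mono)
    then show ?thesis using False by simp
  qed
  then show ?thesis by (simp add: same_order_def reduced_def)
qed

lemma reduced_is_permutation:
  assumes "distinct w"
  shows "reduced w \<in> permutations_of_set {1..length w}"
proof -
  have d: "distinct (reduced w)"
  proof (subst distinct_conv_nth, intro allI impI)
    fix i j assume ij: "i < length (reduced w)" "j < length (reduced w)" "i \<noteq> j"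
    have l: "length (reduced w) = length w" by (simp add: reduced_def)
    have "w ! i \<noteq> w ! j" using ij l assms nth_eq_iff_index_eq by metis
    then have "w ! i < w ! j \<or> w ! j < w ! i" by auto
    then show "reduced w ! i \<noteq> reduced w ! j"
      using same_order_reduced[OF assms] ij l unfolding same_order_def by (metis less_irrefl)
  qed
  have "set (reduced w) \<subseteq> {1..length w}"
  proof
    fix v assume "v \<in> set (reduced w)"
    then obtain a where a: "a \<in> set w" "v = card {b \<in> set w. b \<le> a}"
      by (auto simp: reduced_def)
    have "0 < v" using a by (auto simp: card_gt_0_iff)
    moreover have "v \<le> card (set w)" unfolding a(2) by (rule card_mono) auto
    ultimately show "v \<in> {1..length w}" using assms by (simp add: distinct_card)
  qed
  moreover have "card (set (reduced w)) = length w"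
    using d by (simp add: distinct_card) (simp add: reduced_def)
  ultimately have "set (reduced w) = {1..length w}" by (intro card_subset_eq) auto
  then show ?thesis using d by (simp add: permutations_of_set_def)
qed

lemma perm_gf_1: "perm_gf [1] = 1"
proof -
  have "contains \<sigma> [1 :: nat]" if "\<sigma> \<noteq> []" for \<sigma> :: "nat list"
  proof -
    from that obtain a u where "\<sigma> = a # u" by (cases \<sigma>) auto
    then have "subseq [a] \<sigma>" "same_order [a] [1 :: nat]"
      by (auto simp: same_order_def)
    then show ?thesis unfolding contains_def by blast
  qed
  moreover have "\<not> contains [] [1 :: nat]" "\<not> contains [] [3, 1, 2 :: nat]"
    by (auto simp: contains_def same_order_def)
  ultimately have "\<sigma> \<in> Av n {[3, 1, 2], [1]} \<longleftrightarrow> \<sigma> = [] \<and> n = 0" for n \<sigma>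
    unfolding Av_def permutations_of_set_def by (cases "\<sigma> = []") auto
  then have "Av n {[3, 1, 2], [1]} = (if n = 0 then {[]} else {})" for n
    by auto
  moreover have "{s. subseq s ([] :: nat list) \<and> sorted_wrt (<) s} = {[]}" by auto
  then have "lis ([] :: nat list) = 0" by (simp add: lis_def)
  ultimately show ?thesis
    by (intro fps_ext) (simp add: perm_gf_def one_pCons monom_0)
qed

text \<open>Every 312-avoiding permutation has a normal form.\<close>

lemma rl_minima_split:
  assumes "\<forall>c\<in>set u. a < c" "\<forall>b\<in>set v. a < b"
  shows "rl_minima (u @ a # v) = a # rl_minima v"
  using assms by (induction u) (auto dest: order.asym)

lemma blocks_Suc:
  "blocks (case_nat a m) (case_nat u t) 0 (Suc r) = u @ a # blocks m t 0 r"
proof -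
  have "[0..<Suc (Suc r)] = 0 # map Suc [0..<Suc r]"
    by (simp only: map_Suc_upt upt_conv_Cons[of 0 "Suc (Suc r)"] zero_less_Suc if_True)
  then show ?thesis unfolding blocks_def by (simp add: o_def del: upt_Suc)
qed

lemma blocks_decomposition:
  fixes w :: "'a::linorder list"
  assumes "distinct w" "w \<noteq> []"
    and "\<forall>a b c. subseq [c, a, b] w \<longrightarrow> \<not> (a < b \<and> b < c)"
  shows "\<exists>r m t. rl_minima w = map m [0..<Suc r] \<and> m 0 = Min (set w) \<and>
     (\<forall>j<r. m j < m (Suc j)) \<and> w = blocks m t 0 r \<and>
     (\<forall>j\<le>r. \<forall>a\<in>set (t j). m j < a) \<and> (\<forall>j<r. \<forall>a\<in>set (t j). a < m (Suc j))"
  using assms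
proof (induction "length w" arbitrary: w rule: less_induct)
  case less
  define a where "a = Min (set w)"
  have "a \<in> set w" unfolding a_def using less.prems(2) by simp
  then obtain u v where w: "w = u @ a # v" by (meson split_list)
  have amin: "a \<le> c" if "c \<in> set w" for c unfolding a_def using that by simp
  have au: "\<forall>c\<in>set u. a < c" and av: "\<forall>c\<in>set v. a < c"
    using amin less.prems(1) unfolding w by (auto simp: order.strict_iff_order)
  have uv: "c < b" if "c \<in> set u" "b \<in> set v" for b c
  proof -
    have "subseq [c] u" "subseq [b] v" using that by (auto simp: subseq_singleton_left)
    then have "subseq ([c] @ a # [b]) w" unfolding w
      by (intro list_emb_append_mono) auto
    then have "\<not> b < c" using less.prems(3) av that by auto
    moreover have "b \<noteq> c" using less.prems(1) that unfolding w by auto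
    ultimately show ?thesis by auto
  qed
  have rl: "rl_minima w = a # rl_minima v" unfolding w by (rule rl_minima_split[OF au av])
  show ?case
  proof (cases "v = []")
    case True
    show ?thesis
      by (rule exI[of _ 0], rule exI[of _ "\<lambda>_. a"], rule exI[of _ "\<lambda>_. u"])
         (use True rl au w a_def[symmetric] in \<open>simp add: blocks_def\<close>)
  next
    case False
    have sub: "subseq v w" unfolding w by (rule list_emb_append2, rule list_emb_Cons) simp
    have l: "length v < length w" and d: "distinct v" using less.prems(1) unfolding w by auto
    have n: "\<forall>a b c. subseq [c, a, b] v \<longrightarrow> \<not> (a < b \<and> b < c)"
      using less.prems(3) subseq_order.order_trans[OF _ sub] by blast
    obtain r m t where IH: "rl_minima v = map m [0..<Suc r]" "m 0 = Min (set v)"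
      "\<forall>j<r. m j < m (Suc j)" "v = blocks m t 0 r"
      "\<forall>j\<le>r. \<forall>a\<in>set (t j). m j < a" "\<forall>j<r. \<forall>a\<in>set (t j). a < m (Suc j)"
      using less.hyps[OF l d False n] by (elim exE conjE)
    have m0: "m 0 \<in> set v" using IH(2) False by simp
    have up: "[0..<Suc (Suc r)] = 0 # map Suc [0..<Suc r]"
      by (simp only: map_Suc_upt upt_conv_Cons[of 0 "Suc (Suc r)"] zero_less_Suc if_True)
    let ?m = "case_nat a m" and ?t = "case_nat u t"
    have "rl_minima w = map ?m [0..<Suc (Suc r)]"
      unfolding rl IH(1) up by (simp add: o_def del: upt_Suc)
    moreover have "\<forall>j<Suc r. ?m j < ?m (Suc j)"
      using IH(3) m0 av by (auto split: nat.split)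
    moreover have "w = blocks ?m ?t 0 (Suc r)" using w IH(4) by (simp add: blocks_Suc)
    moreover have "\<forall>j\<le>Suc r. \<forall>a\<in>set (?t j). ?m j < a"
      using IH(5) au by (auto split: nat.split)
    moreover have "\<forall>j<Suc r. \<forall>a\<in>set (?t j). a < ?m (Suc j)"
      using IH(6) uv m0 by (auto split: nat.split)
    moreover have "?m 0 = Min (set w)" by (simp add: a_def)
    ultimately show ?thesis by blast
  qed
qed

lemma normal_form_exists:
  assumes "\<tau> \<in> Av k {[3, 1, 2]}" "k \<ge> 1"
  shows "\<exists>r m t. normal_form \<tau> r m t"
proof -
  have d: "distinct \<tau>" and s: "set \<tau> = {1..k}" and av: "\<not> contains \<tau> [3, 1, 2 :: nat]"
    using assms(1) by (auto simp: Av_def permutations_of_set_def)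
  have "\<forall>a b c. subseq [c, a, b] \<tau> \<longrightarrow> \<not> (a < b \<and> b < c)"
  proof (intro allI impI notI)
    fix a b c assume sub: "subseq [c, a, b] \<tau>" and "a < b \<and> b < c"
    then have "same_order [c, a, b] [3, 1, 2 :: nat]"
      by (auto simp: same_order_def less_Suc_eq)
    then show False using av sub by (auto simp: contains_def)
  qed
  moreover have "\<tau> \<noteq> []" using s assms(2) by auto
  moreover have "Min (set \<tau>) = 1" unfolding s using assms(2) by (intro Min_eqI) auto
  moreover obtain r m t where "rl_minima \<tau> = map m [0..<Suc r]" "m 0 = Min (set \<tau>)"
      "\<forall>j<r. m j < m (Suc j)" "\<tau> = blocks m t 0 r"
      "\<forall>j\<le>r. \<forall>a\<in>set (t j). m j < a" "\<forall>j<r. \<forall>a\<in>set (t j). a < m (Suc j)"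
    using blocks_decomposition[OF d] calculation(1,2) by blast
  ultimately show ?thesis unfolding normal_form_def by (intro exI[of _ r] exI[of _ m] exI[of _ t]) simp
qed

end

theory Submission
  imports Defs
begin

text \<open>
  A nonempty 312-avoiding permutation is uniquely \<open>\<sigma> = a 1 b\<close> with \<open>a < b\<close> and \<open>a\<close>, \<open>b\<close>
  312-avoiding, and the longest increasing subsequences of \<open>a 1\<close> and \<open>b\<close> concatenate. The blocks
  \<open>\<tau>\<^sup>(\<^sup>i\<^sup>) m\<^sub>i\<close> are the sum-indecomposable components of \<open>\<tau>\<close>, so \<open>\<sigma>\<close> contains \<open>\<tau>\<close> iff for some
  \<open>j\<close> the part \<open>a 1\<close> contains the first \<open>j\<close> blocks and \<open>b\<close> the remaining ones. Sorting \<open>a\<close> by the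
  least \<open>j\<close> at which containment fails expresses the avoidance of \<open>\<tau>\<close> as a sum of products of a
  condition on \<open>a\<close> and one on \<open>b\<close>. This gives one recurrence (\<open>F_concat\<close>) covering both cases; they
  differ only in whether the pattern \<open>\<tau>\<^sup>(\<^sup>0\<^sup>)\<close> is empty.
\<close>

section \<open>Order isomorphism and pattern containment\<close>

lemma same_order_trans: "same_order u v \<Longrightarrow> same_order v w \<Longrightarrow> same_order u w"
  by (simp add: same_order_def)

lemma same_order_sym: "same_order u v \<Longrightarrow> same_order v u"
  by (simp add: same_order_def)

lemma contains_same_order:
  assumes "same_order p p'"
  shows "contains \<sigma> p \<longleftrightarrow> contains \<sigma> p'"
  using assms unfolding contains_def by (meson same_order_sym same_order_trans)

lemma contains_Nil [simp]: "contains \<sigma> []"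
  unfolding contains_def same_order_def by (intro exI[of _ "[]"]) simp

lemma contains_Nil_left [simp]: "contains [] p \<longleftrightarrow> p = []"
  by (auto simp: contains_def same_order_def dest: list_emb_length)

lemma same_order_appendD:
  assumes "same_order s (p @ p')"
  obtains s1 s2 where "s = s1 @ s2" "same_order s1 p" "same_order s2 p'"
proof
  let ?l = "length p"
  have l: "length s = ?l + length p'"
    and o: "\<And>i j. i < length s \<Longrightarrow> j < length s \<Longrightarrow> s ! i < s ! j \<longleftrightarrow> (p @ p') ! i < (p @ p') ! j"
    using assms by (auto simp: same_order_def)
  show "s = take ?l s @ drop ?l s" by simp
  show "same_order (take ?l s) p"
    using l o by (fastforce simp: same_order_def nth_append)
  show "same_order (drop ?l s) p'"
    unfolding same_order_def
  proof (intro conjI allI impI)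
    fix i j assume "i < length (drop ?l s)" "j < length (drop ?l s)"
    then show "drop ?l s ! i < drop ?l s ! j \<longleftrightarrow> p' ! i < p' ! j"
      using l o[of "?l + i" "?l + j"] by simp
  qed (use l in simp)
qed

lemma contains_appendD:
  assumes "contains \<sigma> (p @ p')"
  shows "contains \<sigma> p" "contains \<sigma> p'"
proof -
  obtain s where "subseq s \<sigma>" "same_order s (p @ p')"
    using assms by (auto simp: contains_def)
  moreover from this(2) obtain s1 s2 where "s = s1 @ s2" "same_order s1 p" "same_order s2 p'"
    by (rule same_order_appendD)
  moreover have "subseq s1 (s1 @ s2)" "subseq s2 (s1 @ s2)" by auto
  ultimately show "contains \<sigma> p" "contains \<sigma> p'"
    unfolding contains_def by (blast intro: subseq_order.order_trans)+
qed

definition below :: "'a::linorder list \<Rightarrow> 'a list \<Rightarrow> bool" where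
  "below u v \<longleftrightarrow> (\<forall>x\<in>set u. \<forall>y\<in>set v. x < y)"

lemma same_order_append:
  assumes "same_order s p" "same_order s' p'" "below s s'" "below p p'"
  shows "same_order (s @ s') (p @ p')"
proof -
  have l: "length s = length p" "length s' = length p'"
    using assms by (auto simp: same_order_def)
  have b: "s ! i < s' ! j" "\<not> s' ! j < s ! i" "p ! i < p' ! j" "\<not> p' ! j < p ! i"
    if "i < length p" "j < length p'" for i j
    using assms(3,4) that l by (force simp: below_def dest: order.asym)+
  show ?thesis
    using assms(1,2) l b unfolding same_order_def by (auto simp: nth_append)
qed

lemma same_order_belowD:
  assumes "same_order (s @ s') (p @ p')" "length s = length p" "below s s'"
  shows "below p p'"
  unfolding below_def
proof (intro ballI)
  fix x y assume "x \<in> set p" "y \<in> set p'"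
  then obtain i j where "i < length p" "j < length p'" "x = p ! i" "y = p' ! j"
    by (metis in_set_conv_nth)
  moreover have "length s' = length p'" using assms(1,2) by (simp add: same_order_def)
  moreover have "s ! i < s' ! j"
    using assms(2,3) calculation by (auto simp: below_def)
  moreover have "(s @ s') ! i < (s @ s') ! (length p + j) \<longleftrightarrow> (p @ p') ! i < (p @ p') ! (length p + j)"
    using assms(1) calculation by (simp add: same_order_def del: nth_append_length_plus)
  ultimately show "x < y" using assms(2) by (simp add: nth_append)
qed

lemma subseq_set: "subseq s u \<Longrightarrow> set s \<subseteq> set u"
  by (auto elim: list_emb_set)

lemma below_subseq:
  assumes "below u v" "subseq s u" "subseq s' v"
  shows "below s s'"
  using assms unfolding below_def by (meson subseq_set subsetD)

text \<open>An occurrence in \<open>u @ v\<close> is cut into its part in \<open>u\<close> and its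
  part in \<open>v\<close>, and order isomorphism transfers this cut, together with
  \<open>below\<close>, to the pattern. Conversely, occurrences in \<open>u\<close> and in
  \<open>v\<close> can be concatenated because \<open>u\<close> lies below \<open>v\<close>.\<close>

lemma contains_append_iff:
  assumes "below u v"
  shows "contains (u @ v) p \<longleftrightarrow>
    (\<exists>p1 p2. p = p1 @ p2 \<and> below p1 p2 \<and> contains u p1 \<and> contains v p2)"
proof
  assume "contains (u @ v) p"
  then obtain s where s: "subseq s (u @ v)" "same_order s p" by (auto simp: contains_def)
  then obtain s1 s2 where s12: "s = s1 @ s2" "subseq s1 u" "subseq s2 v"
    by (auto simp: subseq_append_iff)
  obtain p1 p2 where p: "p = p1 @ p2" "same_order p1 s1" "same_order p2 s2"
    using same_order_appendD[of p s1 s2] same_order_sym s(2) s12(1) by blast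
  have "below s1 s2"
    using assms s12(2,3) by (rule below_subseq)
  then have "below p1 p2"
  proof (rule same_order_belowD[rotated 2])
    show "same_order (s1 @ s2) (p1 @ p2)" using s(2) unfolding s12(1) p(1) .
    show "length s1 = length p1" using p(2) by (simp add: same_order_def)
  qed
  moreover have "contains u p1" "contains v p2"
    using s12(2,3) p(2,3)[THEN same_order_sym] by (auto simp: contains_def)
  ultimately show "\<exists>p1 p2. p = p1 @ p2 \<and> below p1 p2 \<and> contains u p1 \<and> contains v p2"
    using p(1) by blast
next
  assume "\<exists>p1 p2. p = p1 @ p2 \<and> below p1 p2 \<and> contains u p1 \<and> contains v p2"
  then obtain p1 p2 s1 s2 where p: "p = p1 @ p2" "below p1 p2"
    "subseq s1 u" "same_order s1 p1" "subseq s2 v" "same_order s2 p2"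
    by (auto simp: contains_def)
  have "below s1 s2"
    using assms p(3,5) by (rule below_subseq)
  then have "same_order (s1 @ s2) p" using p same_order_append by blast
  then show "contains (u @ v) p"
    unfolding contains_def using p(3,5) list_emb_append_mono by blast
qed

lemma subseq_map_E:
  assumes "subseq s (map f u)"
  obtains s' where "s = map f s'" "subseq s' u"
  using assms by (metis nths_map subseq_conv_nths)

lemma contains_map:
  assumes "strict_mono f"
  shows "contains (map f u) p \<longleftrightarrow> contains u p"
proof -
  have "same_order (map f s) p \<longleftrightarrow> same_order s p" for s
    by (auto simp: same_order_def strict_mono_less[OF assms])
  then show ?thesis
    unfolding contains_def by (metis subseq_map_E subseq_map)
qed

text \<open>An occurrence either misses the final \<open>z\<close> or uses it. In the second case
  \<open>z\<close> plays the last letter \<open>x\<close>, and its minimality forces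
  \<open>x\<close> to be the minimum of the pattern.\<close>

lemma contains_snoc_min:
  assumes "\<forall>y\<in>set u. z < y"
  shows "contains (u @ [z]) (p @ [x]) \<longleftrightarrow>
    contains u (p @ [x]) \<or> contains u p \<and> (\<forall>y\<in>set p. x < y)"
proof (intro iffI; (elim disjE conjE)?)
  assume "contains (u @ [z]) (p @ [x])"
  then obtain s s' where s: "subseq s u" "subseq s' [z]" "same_order (s @ s') (p @ [x])"
    by (auto simp: contains_def subseq_append_iff)
  show "contains u (p @ [x]) \<or> contains u p \<and> (\<forall>y\<in>set p. x < y)"
  proof (cases "s' = []")
    case True
    then show ?thesis using s by (auto simp: contains_def)
  next
    case False
    have s': "s' = [z]"
      using s(2) False by (cases s') (auto split: if_splits dest: list_emb_length)
    then have l: "length s = length p" using s(3) by (simp add: same_order_def)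
    obtain s1 s2 where s12: "s @ s' = s1 @ s2" "same_order s1 p" "same_order s2 [x]"
      using s(3) by (rule same_order_appendD)
    then have "same_order s p" using l by (simp add: same_order_def)
    moreover have "x < p ! i" if "i < length p" for i
    proof -
      have "z < s ! i" using assms that l subseq_set[OF s(1)] by (metis nth_mem subsetD)
      moreover have "(s @ [z]) ! length p < (s @ [z]) ! i \<longleftrightarrow> (p @ [x]) ! length p < (p @ [x]) ! i"
        using s(3) l that unfolding same_order_def s' by simp
      ultimately show ?thesis using that l by (simp add: nth_append)
    qed
    ultimately show ?thesis
      using s(1) by (auto simp: contains_def in_set_conv_nth)
  qed
next
  assume "contains u (p @ [x])"
  then show "contains (u @ [z]) (p @ [x])"
    unfolding contains_def by (meson subseq_rev_drop_many)
next
  assume "contains u p" and x: "\<forall>y\<in>set p. x < y"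
  then obtain s where s: "subseq s u" "same_order s p" by (auto simp: contains_def)
  have "z < s ! i" if "i < length s" for i
    using assms that subseq_set[OF s(1)] by (metis nth_mem subsetD)
  then have "same_order (s @ [z]) (p @ [x])"
    using s(2) x unfolding same_order_def by (force simp: nth_append less_Suc_eq dest: order.asym)
  then show "contains (u @ [z]) (p @ [x])"
    using s(1) unfolding contains_def by (meson subseq_append)
qed

section \<open>Longest increasing subsequences\<close>

lemma finite_increasing_subseqs: "finite {s. subseq s \<sigma> \<and> sorted_wrt (<) s}"
  by (rule finite_subset[of _ "set (subseqs \<sigma>)"]) auto

lemma length_le_lis: "subseq s \<sigma> \<Longrightarrow> sorted_wrt (<) s \<Longrightarrow> length s \<le> lis \<sigma>"
  unfolding lis_def using finite_increasing_subseqs by (intro Max_ge) auto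

lemma lis_witness:
  obtains s where "subseq s \<sigma>" "sorted_wrt (<) s" "length s = lis \<sigma>"
proof -
  have "lis \<sigma> \<in> length ` {s. subseq s \<sigma> \<and> sorted_wrt (<) s}"
    unfolding lis_def using finite_increasing_subseqs
    by (intro Max_in) (auto intro!: exI[of _ "[]"])
  then show ?thesis using that by auto
qed

lemma lis_Nil [simp]: "lis ([] :: 'a::linorder list) = 0"
  by (rule lis_witness[of "[] :: 'a list"]) (auto dest: list_emb_length)

lemma lis_map:
  assumes "strict_mono f"
  shows "lis (map f u) = lis u"
proof (rule antisym)
  obtain s where s: "subseq s (map f u)" "sorted_wrt (<) s" "length s = lis (map f u)"
    by (rule lis_witness)
  then obtain s' where "s = map f s'" "subseq s' u" using subseq_map_E by blast
  then show "lis (map f u) \<le> lis u"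
    using s length_le_lis[of s' u] by (simp add: sorted_wrt_map strict_mono_less[OF assms])
next
  obtain s where s: "subseq s u" "sorted_wrt (<) s" "length s = lis u"
    by (rule lis_witness)
  then show "lis u \<le> lis (map f u)"
    using length_le_lis[of "map f s" "map f u"]
    by (simp add: sorted_wrt_map strict_mono_less[OF assms] subseq_map)
qed

lemma lis_append:
  assumes "below u v"
  shows "lis (u @ v) = lis u + lis v"
proof (rule antisym)
  obtain s where s: "subseq s (u @ v)" "sorted_wrt (<) s" "length s = lis (u @ v)"
    by (rule lis_witness)
  then obtain s1 s2 where "s = s1 @ s2" "subseq s1 u" "subseq s2 v"
    by (auto simp: subseq_append_iff)
  then show "lis (u @ v) \<le> lis u + lis v"
    using s length_le_lis[of s1 u] length_le_lis[of s2 v] by (auto simp: sorted_wrt_append)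
next
  obtain s1 where s1: "subseq s1 u" "sorted_wrt (<) s1" "length s1 = lis u"
    by (rule lis_witness)
  obtain s2 where s2: "subseq s2 v" "sorted_wrt (<) s2" "length s2 = lis v"
    by (rule lis_witness)
  have "below s1 s2" using assms s1(1) s2(1) by (rule below_subseq)
  then have "sorted_wrt (<) (s1 @ s2)" using s1 s2 by (simp add: sorted_wrt_append below_def)
  moreover have "subseq (s1 @ s2) (u @ v)" using s1(1) s2(1) by (rule list_emb_append_mono)
  ultimately show "lis u + lis v \<le> lis (u @ v)"
    using length_le_lis[of "s1 @ s2" "u @ v"] s1(3) s2(3) by simp
qed

text \<open>A final minimum extends no nonempty increasing subsequence, so it matters only as a
  singleton when \<open>u\<close> is empty. This exceptional case is the source of the correction
  \<open>var_q - 1\<close> in the generating functions.\<close>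

lemma lis_snoc_min:
  assumes "\<forall>y\<in>set u. z < y"
  shows "lis (u @ [z]) = (if u = [] then 1 else lis u)"
proof -
  have ge1: "1 \<le> lis w" if "w \<noteq> []" for w :: "'a list"
    using that length_le_lis[of "[hd w]" w] by (simp add: subseq_singleton_left)
  have "lis u \<le> lis (u @ [z])"
    by (rule lis_witness[of u]) (metis length_le_lis subseq_rev_drop_many)
  moreover have "lis (u @ [z]) \<le> max 1 (lis u)"
  proof -
    obtain s where s: "subseq s (u @ [z])" "sorted_wrt (<) s" "length s = lis (u @ [z])"
      by (rule lis_witness)
    then obtain s1 s2 where s12: "s = s1 @ s2" "subseq s1 u" "subseq s2 [z]"
      by (auto simp: subseq_append_iff)
    show ?thesis
    proof (cases "s2 = []")
      case True
      then show ?thesis using s s12 length_le_lis[of s1 u] by simp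
    next
      case False
      then have s2: "s2 = [z]"
        using s12(3) by (cases s2) (auto split: if_splits dest: list_emb_length)
      have "s1 = []"
      proof (rule ccontr)
        assume "s1 \<noteq> []"
        then have "hd s1 < z" "hd s1 \<in> set u"
          using s(2) s12 s2 subseq_set[of s1 u] by (auto simp: sorted_wrt_append)
        then show False using assms by auto
      qed
      then show ?thesis using s(3) s12 s2 by simp
    qed
  qed
  ultimately show ?thesis using ge1[of "u @ [z]"] ge1[of u] by auto
qed

section \<open>The decomposition of 312-avoiders around the entry 1\<close>

definition glue :: "nat list \<Rightarrow> nat list \<Rightarrow> nat list" where
  "glue a b = map Suc a @ 1 # map ((+) (Suc (length a))) b"

lemma glue_append: "glue a b = (map Suc a @ [1]) @ map ((+) (Suc (length a))) b"
  by (simp add: glue_def)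

lemma Av_D:
  assumes "a \<in> Av n T"
  shows "length a = n" "distinct a" "set a = {1..n}"
  using assms by (auto simp: Av_def permutations_of_set_def dest: distinct_card)

lemma glue_below:
  assumes "a \<in> Av i T" "b \<in> Av j T'"
  shows "below (map Suc a @ [1]) (map ((+) (Suc (length a))) b)" "\<forall>y\<in>set (map Suc a). 1 < y"
  using Av_D[OF assms(1)] Av_D[OF assms(2)] by (auto simp: below_def)

lemma strict_mono_Suc: "strict_mono Suc"
  by (simp add: strict_mono_def)

lemma strict_mono_plus: "strict_mono ((+) (c::nat))"
  by (simp add: strict_mono_def)

lemma lis_glue:
  assumes "a \<in> Av i T" "b \<in> Av j T'"
  shows "lis (glue a b) = (if a = [] then 1 else lis a) + lis b"
  using lis_append[OF glue_below(1)[OF assms]] lis_snoc_min[OF glue_below(2)[OF assms]]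
    lis_map[OF strict_mono_Suc, of a] lis_map[OF strict_mono_plus, of "Suc (length a)" b]
  unfolding glue_append by simp

lemma glue_in_Av:
  assumes "a \<in> Av i {[3, 1, 2]}" "b \<in> Av j {[3, 1, 2]}"
  shows "glue a b \<in> Av (Suc (i + j)) {[3, 1, 2]}"
proof -
  note A = Av_D[OF assms(1)] and B = Av_D[OF assms(2)]
  have "set (glue a b) = insert 1 (Suc ` {1..i} \<union> (+) (Suc i) ` {1..j})"
    using A B by (auto simp: glue_def)
  also have "\<dots> = {1..Suc (i + j)}"
    unfolding image_Suc_atLeastAtMost image_add_atLeastAtMost by auto
  finally have set: "set (glue a b) = {1..Suc (i + j)}" .
  moreover have "distinct (glue a b)"
    using set A B by (intro card_distinct) (simp add: glue_def)
  moreover have "\<not> contains (glue a b) [3, 1, 2 :: nat]"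
  proof
    assume "contains (glue a b) [3, 1, 2 :: nat]"
    then obtain p1 p2 where p: "[3, 1, 2 :: nat] = p1 @ p2" "below p1 p2"
      "contains (map Suc a @ [1]) p1" "contains (map ((+) (Suc (length a))) b) p2"
      by (simp only: glue_append contains_append_iff[OF glue_below(1)[OF assms]]) (elim exE conjE)
    \<comment> \<open>Unless the occurrence lies in one factor, the letter 3 is on the left and a
      smaller letter on the right, against \<open>below p1 p2\<close>.\<close>
    consider "p1 = []" | "p1 = [3, 1, 2]" | "p2 \<noteq> []" "3 \<in> set p1" "1 \<in> set p2 \<or> 2 \<in> set p2"
      using p(1) by (auto simp: Cons_eq_append_conv)
    then show False
    proof cases
      case 1
      then show ?thesis
        using p assms(2) contains_map[OF strict_mono_plus] by (auto simp: Av_def)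
    next
      case 2
      \<comment> \<open>The final entry 1 cannot play the letter 2, which is not the minimum of 312,
        so the occurrence already lies in \<open>a\<close>.\<close>
      then have "contains (map Suc a @ [1]) ([3, 1] @ [2 :: nat])" using p(3) by simp
      then have "contains (map Suc a) [3, 1, 2 :: nat]"
        unfolding contains_snoc_min[OF glue_below(2)[OF assms]] by simp
      then show ?thesis
        using assms(1) unfolding contains_map[OF strict_mono_Suc] by (simp add: Av_def)
    next
      case 3
      then show ?thesis using p(2) by (fastforce simp: below_def)
    qed
  qed
  ultimately show ?thesis by (auto simp: Av_def permutations_of_set_def)
qed

text \<open>The entry 1 occurs only once, so the entries before it determine \<open>a\<close>, and
  thereby also the shift that was applied to \<open>b\<close>.\<close>

lemma glue_inject:
  assumes "glue a b = glue a' b'" "a \<in> Av i T" "a' \<in> Av i' T"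
  shows "a = a' \<and> b = b'"
proof -
  have *: "takeWhile (\<lambda>x. x \<noteq> 1) (glue c d) = map Suc c" if "c \<in> Av l T" for c d l
    using Av_D(3)[OF that] by (subst glue_def, subst takeWhile_append2) auto
  have "map Suc a = map Suc a'"
    using *[OF assms(2), of b] *[OF assms(3), of b'] assms(1) by simp
  then have "a = a'" by (simp add: inj_map_eq_map)
  moreover from this have "b = b'"
    using assms(1) by (simp add: glue_def inj_map_eq_map)
  ultimately show ?thesis ..
qed

lemma glue_surj:
  assumes "\<sigma> \<in> Av (Suc n) {[3, 1, 2]}"
  obtains i a b where "i \<le> n" "a \<in> Av i {[3, 1, 2]}" "b \<in> Av (n - i) {[3, 1, 2]}" "\<sigma> = glue a b"
proof -
  note S = Av_D[OF assms]
  have "1 \<in> set \<sigma>" using S by auto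
  then obtain u v where \<sigma>: "\<sigma> = u @ 1 # v" by (meson split_list)
  have av: "\<not> contains \<sigma> [3, 1, 2 :: nat]" using assms by (simp add: Av_def)
  have uv: "set u \<union> set v = {2..Suc n}"
  proof -
    have "set u \<union> set v = set \<sigma> - {1}"
      using S(2) unfolding \<sigma> by auto
    also have "\<dots> = {2..Suc n}"
      unfolding S(3) by (auto simp del: One_nat_def)
    finally show ?thesis .
  qed
  \<comment> \<open>A larger entry before the 1 and a smaller one after it would form a 312 with the
    1 in the middle.\<close>
  have lt: "c < b" if "c \<in> set u" "b \<in> set v" for b c
  proof -
    have "subseq [c] u" "subseq [b] v" using that by (auto simp: subseq_singleton_left)
    then have sub: "subseq ([c] @ 1 # [b]) \<sigma>" unfolding \<sigma>
      by (intro list_emb_append_mono) auto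
    have "b \<in> {2..Suc n}" unfolding uv[symmetric] using that by simp
    then have "1 < b" by simp
    then have "same_order [c, 1, b] [3, 1, 2 :: nat]" if "b < c"
      using that by (auto simp: same_order_def less_Suc_eq)
    then have "\<not> b < c" using av sub by (auto simp: contains_def)
    moreover have "b \<noteq> c" using S that unfolding \<sigma> by auto
    ultimately show ?thesis by auto
  qed
  let ?i = "length u"
  have i: "?i \<le> n" using S(1) \<sigma> by simp
  have u: "set u = {2..Suc ?i}"
  proof (cases "u = []")
    case False
    let ?M = "Max (set u)"
    have M: "?M \<in> set u" using False by simp
    then have M': "?M \<in> {2..Suc n}" unfolding uv[symmetric] by simp
    \<comment> \<open>By \<open>lt\<close> a value after the 1 exceeds \<open>?M\<close>, so every
      value from 2 to \<open>?M\<close> occurs before the 1.\<close>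
    have uM: "set u = {2..?M}"
    proof (intro equalityI subsetI)
      fix x assume "x \<in> {2..?M}"
      moreover from this have "x \<in> set u \<union> set v" using M' unfolding uv by simp
      ultimately show "x \<in> set u" using lt[OF M] by fastforce
    qed (use uv in auto)
    moreover have "?i = ?M - 1"
    proof -
      have "?i = card (set u)" using S(2) unfolding \<sigma> by (simp add: distinct_card)
      also have "\<dots> = card {2..?M}" using uM by (rule arg_cong)
      finally show ?thesis by simp
    qed
    moreover have "2 \<le> ?M" using M' by simp
    ultimately show ?thesis by simp
  qed simp
  have v: "set v = {?i + 2..Suc n}"
  proof -
    have "set v = (set u \<union> set v) - set u"
      using S(2) unfolding \<sigma> by auto
    also have "\<dots> = {2..Suc n} - {2..Suc ?i}" by (simp only: uv) (simp only: u)
    also have "\<dots> = {?i + 2..Suc n}" by auto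
    finally show ?thesis .
  qed
  define a where "a = map (\<lambda>x. x - 1) u"
  define b where "b = map (\<lambda>x. x - Suc ?i) v"
  have ua: "map Suc a = u"
    unfolding a_def map_map using u by (intro map_idI) auto
  have vb: "map ((+) (Suc ?i)) b = v"
    unfolding b_def map_map using v by (intro map_idI) auto
  have "\<sigma> = glue a b" using ua vb \<sigma> by (simp add: glue_def a_def)
  moreover have "a \<in> Av ?i {[3, 1, 2]}"
  proof -
    have "Suc ` set a = set u" using ua by (metis list.set_map)
    also have "\<dots> = Suc ` {1..?i}" unfolding u by (simp add: numeral_2_eq_2)
    finally have "Suc ` set a = Suc ` {1..?i}" .
    then have "set a = {1..?i}" by (simp only: inj_image_eq_iff[OF inj_Suc])
    moreover have "distinct a" using ua S(2) unfolding \<sigma> by (metis distinct_append distinct_map)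
    moreover have "\<not> contains a [3, 1, 2 :: nat]"
      using av contains_map[OF strict_mono_Suc, of a "[3, 1, 2 :: nat]"]
      unfolding ua \<sigma> contains_def by (meson subseq_rev_drop_many)
    ultimately show ?thesis by (simp add: Av_def permutations_of_set_def)
  qed
  moreover have "b \<in> Av (n - ?i) {[3, 1, 2]}"
  proof -
    have "(+) (Suc ?i) ` set b = set v" using vb by (metis list.set_map)
    also have "\<dots> = (+) (Suc ?i) ` {1..n - ?i}"
      unfolding v image_add_atLeastAtMost using i by simp
    finally have "(+) (Suc ?i) ` set b = (+) (Suc ?i) ` {1..n - ?i}" .
    then have "set b = {1..n - ?i}"
      by (simp only: inj_image_eq_iff[OF strict_mono_imp_inj_on[OF strict_mono_plus]])
    moreover have "distinct b" using vb S(2) unfolding \<sigma> by (metis distinct.simps(2) distinct_append distinct_map)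
    moreover have "\<not> contains b [3, 1, 2 :: nat]"
      using av contains_map[OF strict_mono_plus, of "Suc ?i" b "[3, 1, 2 :: nat]"]
      unfolding vb \<sigma> contains_def by (meson list_emb_Cons subseq_drop_many)
    ultimately show ?thesis by (simp add: Av_def permutations_of_set_def)
  qed
  ultimately show ?thesis using that i by blast
qed

lemma finite_Av: "finite (Av n T)"
  by (simp add: Av_def)

lemma Av_0: "[] \<notin> T \<Longrightarrow> Av 0 T = {[]}"
  by (auto simp: Av_def)

lemma sum_Av_Suc:
  "(\<Sum>\<sigma>\<in>Av (Suc n) {[3, 1, 2]}. f \<sigma>) =
    (\<Sum>i=0..n. \<Sum>a\<in>Av i {[3, 1, 2]}. \<Sum>b\<in>Av (n - i) {[3, 1, 2]}. f (glue a b))"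
proof -
  let ?A = "\<lambda>n. Av n {[3, 1, 2]}"
  let ?S = "SIGMA i:{0..n}. ?A i \<times> ?A (n - i)"
  have "bij_betw (\<lambda>(i, a, b). glue a b) ?S (?A (Suc n))"
    unfolding bij_betw_def
  proof (intro conjI equalityI subsetI)
    show "inj_on (\<lambda>(i, a, b). glue a b) ?S"
      by (auto simp: inj_on_def dest: glue_inject Av_D(1))
    fix \<sigma>
    show "\<sigma> \<in> ?A (Suc n)" if "\<sigma> \<in> (\<lambda>(i, a, b). glue a b) ` ?S"
      using that glue_in_Av by fastforce
    show "\<sigma> \<in> (\<lambda>(i, a, b). glue a b) ` ?S" if "\<sigma> \<in> ?A (Suc n)"
      using that by (rule glue_surj) force
  qed
  then have "(\<Sum>\<sigma>\<in>?A (Suc n). f \<sigma>) = (\<Sum>(i, a, b)\<in>?S. f (glue a b))"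
    by (simp add: sum.reindex_bij_betw[symmetric] case_prod_beta)
  also have "\<dots> = (\<Sum>i=0..n. \<Sum>(a, b)\<in>?A i \<times> ?A (n - i). f (glue a b))"
    by (subst sum.Sigma) (auto simp: finite_Av)
  finally show ?thesis by (simp add: sum.cartesian_product)
qed

section \<open>Generating functions of weighted 312-avoiders\<close>

text \<open>Arbitrary polynomial weights are allowed, rather than indicators of avoidance, because
  sorting by the first failure produces differences of indicators.\<close>

definition weight_gf :: "(nat list \<Rightarrow> int poly) \<Rightarrow> int poly fps" where
  "weight_gf f = Abs_fps (\<lambda>n. \<Sum>\<sigma>\<in>Av n {[3, 1, 2]}. f \<sigma>)"

lemma weight_gf_diff: "weight_gf (\<lambda>\<sigma>. f \<sigma> - g \<sigma>) = weight_gf f - weight_gf g"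
  by (rule fps_ext) (simp add: weight_gf_def sum_subtractf)

text \<open>The bijection \<open>glue\<close> turns a weight that is a sum of products into a sum of
  Cauchy products. The constant term comes from the empty permutation and the factor
  \<open>fps_X\<close> from the entry 1.\<close>

lemma weight_gf_glue:
  assumes "\<And>i j a b. a \<in> Av i {[3, 1, 2]} \<Longrightarrow> b \<in> Av j {[3, 1, 2]} \<Longrightarrow>
    f (glue a b) = (\<Sum>l<N. u l a * v l b)"
  shows "weight_gf f = fps_const (f []) + fps_X * (\<Sum>l<N. weight_gf (u l) * weight_gf (v l))"
proof (rule fps_ext)
  fix n
  let ?A = "\<lambda>n. Av n {[3, 1, 2]}"
  show "fps_nth (weight_gf f) n =
    fps_nth (fps_const (f []) + fps_X * (\<Sum>l<N. weight_gf (u l) * weight_gf (v l))) n"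
  proof (cases n)
    case 0
    then show ?thesis by (simp add: weight_gf_def Av_0)
  next
    case (Suc k)
    have "fps_nth (weight_gf f) n =
      (\<Sum>i=0..k. \<Sum>a\<in>?A i. \<Sum>b\<in>?A (k - i). \<Sum>l<N. u l a * v l b)"
      unfolding Suc weight_gf_def fps_nth_Abs_fps sum_Av_Suc
      by (intro sum.cong refl assms)
    also have "\<dots> = (\<Sum>i=0..k. \<Sum>l<N. (\<Sum>a\<in>?A i. u l a) * (\<Sum>b\<in>?A (k - i). v l b))"
      by (simp only: sum_product sum.swap[of _ "{..<N}"])
    also have "\<dots> = (\<Sum>l<N. \<Sum>i=0..k. (\<Sum>a\<in>?A i. u l a) * (\<Sum>b\<in>?A (k - i). v l b))"
      by (rule sum.swap)
    also have "\<dots> = fps_nth (\<Sum>l<N. weight_gf (u l) * weight_gf (v l)) k"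
      by (simp add: weight_gf_def fps_sum_nth fps_mult_nth)
    finally show ?thesis by (simp add: Suc)
  qed
qed

lemma reduced_Nil_iff [simp]: "reduced w = [] \<longleftrightarrow> w = []"
  by (simp add: reduced_def)

lemma F_reduced:
  assumes "distinct w"
  shows "F (reduced w) = F w"
  using reduced_permutation[OF reduced_is_permutation[OF assms]] by (simp add: F_def)

text \<open>This puts \<open>F\<close> in a form without \<open>reduced\<close> that also covers the
  empty word: every permutation contains it, which matches the convention
  \<open>F [] = 0\<close>.\<close>

lemma F_weight_gf:
  assumes "distinct w"
  shows "F w = weight_gf (\<lambda>\<sigma>. of_bool (\<not> contains \<sigma> w) * monom 1 (lis \<sigma>))"
proof (cases "w = []")
  case True
  then show ?thesis by (intro fps_ext) (simp add: F_def weight_gf_def)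
next
  case False
  have "contains \<sigma> (reduced w) \<longleftrightarrow> contains \<sigma> w" for \<sigma> :: "nat list"
    by (rule contains_same_order[OF same_order_reduced[OF assms]])
  then have "Av n {[3, 1, 2], reduced w} = {\<sigma> \<in> Av n {[3, 1, 2]}. \<not> contains \<sigma> w}" for n
    by (auto simp: Av_def)
  then show ?thesis
    using False by (intro fps_ext)
      (simp add: F_def perm_gf_def weight_gf_def sum.inter_filter[OF finite_Av] of_bool_def
        if_distrib[of "\<lambda>c. c * _"] cong: if_cong)
qed

text \<open>
  The weight of \<open>a\<close> in \<open>a 1 b\<close> is that of \<open>a 1\<close>, which differs from that of \<open>a\<close> only for
  \<open>a = []\<close>.
\<close>

lemma weight_gf_snoc_min:
  assumes "distinct w"
  shows "weight_gf (\<lambda>\<sigma>. of_bool (\<not> contains \<sigma> w) * monom 1 (if \<sigma> = [] then 1 else lis \<sigma>)) =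
    F w + of_bool (w \<noteq> []) * (var_q - 1)" (is "weight_gf ?f = _")
proof (rule fps_ext)
  fix n
  show "fps_nth (weight_gf ?f) n = fps_nth (F w + of_bool (w \<noteq> []) * (var_q - 1)) n"
  proof (cases n)
    case 0
    then show ?thesis
      by (simp add: F_weight_gf[OF assms] weight_gf_def Av_0 monom_0 one_pCons)
  next
    case (Suc k)
    have "\<sigma> \<noteq> []" if "\<sigma> \<in> Av n {[3, 1, 2]}" for \<sigma>
      using Av_D(1)[OF that] Suc by auto
    then show ?thesis
      using Suc by (auto simp: F_weight_gf[OF assms] weight_gf_def of_bool_def intro!: sum.cong)
  qed
qed

text \<open>\<open>P\<close> starts false and stays true once it is true, so at most one difference
  is nonzero, at the last index where \<open>P\<close> fails. As \<open>C\<close> is inherited by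
  smaller indices, \<open>C\<close> at that index is equivalent to \<open>C\<close> at all indices
  where \<open>P\<close> fails.\<close>

lemma sum_first_failure:
  fixes P C :: "nat \<Rightarrow> bool"
  assumes "\<not> P 0" "\<And>i. i < N \<Longrightarrow> P i \<Longrightarrow> P (Suc i)" "\<And>i. C (Suc i) \<Longrightarrow> C i"
  shows "(of_bool (P N \<and> (\<forall>i<N. \<not> P i \<longrightarrow> C i)) :: 'a::ring_1) =
    (\<Sum>i<N. (of_bool (P (Suc i)) - of_bool (P i)) * of_bool (C i))"
  using assms(2)
proof (induction N)
  case 0
  then show ?case using assms(1) by simp
next
  case (Suc N)
  have C: "C i" if "C N" "i \<le> N" for i
    using that(2,1) by (induction rule: inc_induct) (auto intro: assms(3))
  have P: "\<not> P i" if "\<not> P N" "i \<le> N" for i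
    using that(2,1) by (induction rule: inc_induct) (use Suc.prems in auto)
  show ?case
    using Suc.IH[symmetric] Suc.prems C P by (cases "P N") (auto simp: less_Suc_eq)
qed

section \<open>Patterns composed of blocks, and their recurrence\<close>

definition ends_with_min :: "'a::linorder list \<Rightarrow> bool" where
  "ends_with_min w \<longleftrightarrow> (\<exists>u x. w = u @ [x] \<and> (\<forall>y\<in>set u. x < y))"

text \<open>A cut strictly inside a block would leave the minimum of that block to the right of some
  of its larger entries, so the left part could not lie below the right part. Hence only cuts
  between blocks remain.\<close>

lemma concat_eq_append_below:
  assumes "\<forall>w\<in>set bs. ends_with_min w" "concat bs = p1 @ p2" "below p1 p2"
  shows "\<exists>i\<le>length bs. p1 = concat (take i bs) \<and> p2 = concat (drop i bs)"
  using assms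
proof (induction bs arbitrary: p1 p2)
  case Nil
  then show ?case by simp
next
  case (Cons w bs)
  from Cons.prems(2) obtain us
    where "w = p1 @ us \<and> us @ concat bs = p2 \<or> w @ us = p1 \<and> concat bs = us @ p2"
    by (auto simp: append_eq_append_conv2)
  then show ?case
  proof (elim disjE conjE)
    assume p: "w @ us = p1" "concat bs = us @ p2"
    then have "below us p2" using Cons.prems(3) by (auto simp: below_def)
    then obtain i where "i \<le> length bs" "us = concat (take i bs)" "p2 = concat (drop i bs)"
      using Cons.IH[OF _ p(2)] Cons.prems(1) by auto
    then show ?thesis using p(1) by (intro exI[of _ "Suc i"]) auto
  next
    assume w: "w = p1 @ us" and p2: "us @ concat bs = p2"
    obtain u x where u: "w = u @ [x]" "\<forall>y\<in>set u. x < y"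
      using Cons.prems(1) by (auto simp: ends_with_min_def)
    show ?thesis
    proof (cases "us = []")
      case True
      then show ?thesis using w p2 by (intro exI[of _ 1]) auto
    next
      case False
      then obtain us' where us: "us = us' @ [x]" "u = p1 @ us'"
        using w u(1) by (metis append_butlast_last_id append_assoc butlast_append butlast_snoc last_appendR last_snoc)
      have "p1 = []"
      proof (rule ccontr)
        assume "p1 \<noteq> []"
        then have "hd p1 < x" "x < hd p1"
          using Cons.prems(3) u(2) us p2 by (auto simp: below_def)
        then show False by simp
      qed
      then show ?thesis using w p2 by (intro exI[of _ 0]) auto
    qed
  qed
qed

lemma below_take_drop:
  assumes "sorted_wrt below bs"
  shows "below (concat (take i bs)) (concat (drop i bs))"
proof -
  have "sorted_wrt below (take i bs @ drop i bs)" using assms by simp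
  then show ?thesis unfolding sorted_wrt_append by (fastforce simp: below_def)
qed

text \<open>
  The final 1 of \<open>a 1\<close> can only play the minimum of a pattern that ends in its minimum; among the
  prefixes of \<open>concat bs\<close> only the first block is one. Hence \<open>a 1\<close> contains the first \<open>i\<close>
  blocks iff \<open>a\<close> contains \<open>front bs i\<close>.
\<close>

definition front :: "'a list list \<Rightarrow> nat \<Rightarrow> 'a list" where
  "front bs i = (if i = 1 then butlast (concat (take 1 bs)) else concat (take i bs))"

lemma contains_snoc_front:
  assumes "\<forall>w\<in>set bs. ends_with_min w" "sorted_wrt below bs" "i \<le> length bs"
    and "\<forall>y\<in>set u. z < y"
  shows "contains (u @ [z]) (concat (take i bs)) \<longleftrightarrow> contains u (front bs i)"
proof -
  consider "i = 0" | "i = 1" | k where "i = Suc (Suc k)"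
    by (metis One_nat_def not0_implies_Suc)
  then show ?thesis
  proof cases
    case 1
    then show ?thesis by (simp add: front_def)
  next
    case 2
    then obtain w bs' where bs: "bs = w # bs'" using assms(3) by (cases bs) auto
    then obtain p x where w: "w = p @ [x]" "\<forall>y\<in>set p. x < y"
      using assms(1) by (auto simp: ends_with_min_def)
    \<comment> \<open>Here \<open>x\<close> is the minimum of the pattern, so the added
      \<open>z\<close> can always play it.\<close>
    have "contains (u @ [z]) (p @ [x]) \<longleftrightarrow> contains u p"
      using contains_snoc_min[OF assms(4), of p x] w(2) contains_appendD(1) by blast
    then show ?thesis using 2 bs w(1) by (simp add: front_def)
  next
    case 3
    let ?w = "bs ! Suc k"
    have "?w \<in> set bs" using 3 assms(3) by simp
    then obtain p x where w: "?w = p @ [x]" using assms(1) by (auto simp: ends_with_min_def)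
    \<comment> \<open>The first block provides a letter \<open>y\<close> smaller than
      \<open>x\<close>, so \<open>x\<close> is not the minimum of the prefix and \<open>z\<close>
      cannot play it.\<close>
    obtain v bs' where bs: "bs = v # bs'" using 3 assms(3) by (cases bs) auto
    then obtain p' y where v: "v = p' @ [y]" using assms(1) by (auto simp: ends_with_min_def)
    have "?w \<in> set bs'" using bs 3 assms(3) by auto
    then have "below v ?w" using assms(2) bs by simp
    then have "y < x" unfolding v w by (simp add: below_def)
    moreover have "y \<in> set (concat (take (Suc k) bs) @ p)" using bs v by simp
    ultimately have "\<not> (\<forall>y\<in>set (concat (take (Suc k) bs) @ p). x < y)"
      using order.asym by blast
    moreover have "concat (take i bs) = (concat (take (Suc k) bs) @ p) @ [x]"
      using 3 assms(3) w take_Suc_conv_app_nth[of "Suc k" bs] by simp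
    ultimately have "contains (u @ [z]) (concat (take i bs)) \<longleftrightarrow> contains u (concat (take i bs))"
      using contains_snoc_min[OF assms(4), of "concat (take (Suc k) bs) @ p" x] by metis
    then show ?thesis using 3 by (simp add: front_def)
  qed
qed

lemma contains_front_Suc:
  assumes "i < length bs" "contains \<sigma> (front bs (Suc i))"
  shows "contains \<sigma> (front bs i)"
proof (cases "i = 0")
  case False
  \<comment> \<open>Since \<open>Suc i\<close> is not 1, this is a full prefix; only the target
    \<open>front bs i\<close> may be shortened, namely for \<open>i = 1\<close>.\<close>
  have t: "front bs (Suc i) = concat (take i bs) @ bs ! i"
    using False assms(1) by (simp add: front_def take_Suc_conv_app_nth)
  have "contains \<sigma> (concat (take i bs))"
    using assms(2) unfolding t by (rule contains_appendD(1))
  moreover have "contains \<sigma> (butlast p)" if "contains \<sigma> p" for p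
    using that by (cases p rule: rev_cases) (auto dest: contains_appendD(1))
  ultimately show ?thesis by (cases "i = 1") (simp_all add: front_def)
qed (simp add: front_def)

lemma contains_drop_Suc:
  assumes "contains \<sigma> (concat (drop i bs))"
  shows "contains \<sigma> (concat (drop (Suc i) bs))"
proof (cases "i < length bs")
  case True
  then have "concat (drop i bs) = bs ! i @ concat (drop (Suc i) bs)"
    by (metis Cons_nth_drop_Suc concat.simps(2))
  then show ?thesis using assms contains_appendD(2) by metis
qed simp

text \<open>The pattern can be cut only between blocks, and \<open>front\<close> absorbs the effect
  of the entry 1 that follows \<open>a\<close>.\<close>

lemma contains_glue_iff:
  assumes "\<forall>w\<in>set bs. ends_with_min w" "sorted_wrt below bs"
    and "a \<in> Av i T" "b \<in> Av j T'"
  shows "contains (glue a b) (concat bs) \<longleftrightarrow>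
    (\<exists>l\<le>length bs. contains a (front bs l) \<and> contains b (concat (drop l bs)))"
    (is "_ \<longleftrightarrow> ?R")
proof -
  have "contains (glue a b) (concat bs) \<longleftrightarrow> (\<exists>p1 p2. concat bs = p1 @ p2 \<and> below p1 p2 \<and>
      contains (map Suc a @ [1]) p1 \<and> contains b p2)"
    unfolding glue_append contains_append_iff[OF glue_below(1)[OF assms(3,4)]]
      contains_map[OF strict_mono_plus] ..
  also have "\<dots> \<longleftrightarrow> (\<exists>l\<le>length bs. contains (map Suc a @ [1]) (concat (take l bs)) \<and>
      contains b (concat (drop l bs)))" (is "?P \<longleftrightarrow> ?Q")
  proof
    assume ?P
    then show ?Q using concat_eq_append_below[OF assms(1)] by blast
  next
    assume ?Q
    moreover have "concat bs = concat (take l bs) @ concat (drop l bs)" for l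
      by (metis append_take_drop_id concat_append)
    ultimately show ?P using below_take_drop[OF assms(2)] by blast
  qed
  also have "\<dots> \<longleftrightarrow> ?R"
    using contains_snoc_front[OF assms(1,2) _ glue_below(2)[OF assms(3,4)]]
    by (auto simp: contains_map[OF strict_mono_Suc])
  finally show ?thesis .
qed

text \<open>The difference \<open>W (Suc i) - W i\<close> counts the \<open>a\<close> that contain
  \<open>front bs i\<close> but not \<open>front bs (Suc i)\<close>, weighted as in
  \<open>a 1\<close>. For such \<open>a\<close> the permutation \<open>glue a b\<close> avoids the
  pattern iff \<open>b\<close> avoids the blocks from index \<open>i\<close> on.\<close>

lemma F_concat:
  fixes bs :: "nat list list"
  assumes "\<forall>w\<in>set bs. ends_with_min w" "sorted_wrt below bs" "distinct (concat bs)" "bs \<noteq> []"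
  defines "W \<equiv> \<lambda>i. F (front bs i) + of_bool (front bs i \<noteq> []) * (var_q - 1)"
  shows "F (concat bs) =
    1 + var_x * (\<Sum>i<length bs. (W (Suc i) - W i) * F (concat (drop i bs)))"
proof -
  have "concat bs = concat (take i bs) @ concat (drop i bs)" for i
    by (metis append_take_drop_id concat_append)
  then have d: "distinct (concat (take i bs))" "distinct (concat (drop i bs))" for i
    using assms(3) by (metis distinct_append)+
  then have d': "distinct (front bs i)" for i by (simp add: front_def distinct_butlast)
  have ne: "concat bs \<noteq> []" using assms(1,4) by (cases bs) (auto simp: ends_with_min_def)
  define f :: "nat list \<Rightarrow> int poly"
    where "f \<sigma> = of_bool (\<not> contains \<sigma> (concat bs)) * monom 1 (lis \<sigma>)" for \<sigma>
  define u :: "nat \<Rightarrow> nat list \<Rightarrow> int poly"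
    where "u i \<sigma> = of_bool (\<not> contains \<sigma> (front bs i)) * monom 1 (if \<sigma> = [] then 1 else lis \<sigma>)" for i \<sigma>
  define v :: "nat \<Rightarrow> nat list \<Rightarrow> int poly"
    where "v i \<sigma> = of_bool (\<not> contains \<sigma> (concat (drop i bs))) * monom 1 (lis \<sigma>)" for i \<sigma>
  have "f (glue a b) = (\<Sum>i<length bs. (u (Suc i) a - u i a) * v i b)"
    if "a \<in> Av i {[3, 1, 2]}" "b \<in> Av j {[3, 1, 2]}" for a b i j
  proof -
    let ?P = "\<lambda>i. \<not> contains a (front bs i)" and ?C = "\<lambda>i. \<not> contains b (concat (drop i bs))"
    \<comment> \<open>At the cut \<open>length bs\<close> nothing is left for \<open>b\<close>, and
      the empty pattern is always contained; so this cut contributes just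
      \<open>?P (length bs)\<close>.\<close>
    have "\<not> contains (glue a b) (concat bs) \<longleftrightarrow>
        ?P (length bs) \<and> (\<forall>i<length bs. \<not> ?P i \<longrightarrow> ?C i)"
      unfolding contains_glue_iff[OF assms(1,2) that] by (auto simp: le_less)
    then have "(of_bool (\<not> contains (glue a b) (concat bs)) :: int poly) =
        (\<Sum>i<length bs. (of_bool (?P (Suc i)) - of_bool (?P i)) * of_bool (?C i))"
    proof (simp only:, intro sum_first_failure)
      show "\<not> ?P 0" by (simp add: front_def)
      show "?P (Suc l)" if "l < length bs" "?P l" for l
        using that contains_front_Suc by blast
      show "?C l" if "?C (Suc l)" for l
        using that contains_drop_Suc by blast
    qed
    moreover have "(monom 1 (lis (glue a b)) :: int poly) =
        monom 1 (if a = [] then 1 else lis a) * monom 1 (lis b)"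
      unfolding lis_glue[OF that] by (simp add: mult_monom)
    ultimately show ?thesis
      unfolding f_def u_def v_def by (simp only: sum_distrib_right) (intro sum.cong refl, simp add: algebra_simps)
  qed
  then have "weight_gf f = fps_const (f []) +
      fps_X * (\<Sum>i<length bs. weight_gf (\<lambda>\<sigma>. u (Suc i) \<sigma> - u i \<sigma>) * weight_gf (v i))"
    by (rule weight_gf_glue)
  moreover have "weight_gf f = F (concat bs)"
    unfolding f_def using F_weight_gf[OF assms(3)] by simp
  moreover have "weight_gf (v i) = F (concat (drop i bs))" for i
    unfolding v_def using F_weight_gf[OF d(2)] by simp
  moreover have "weight_gf (u i) = W i" for i
    unfolding u_def W_def by (rule weight_gf_snoc_min[OF d'])
  moreover have "f [] = 1" using ne by (simp add: f_def monom_0 one_pCons)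
  ultimately show ?thesis by (simp add: weight_gf_diff)
qed

section \<open>Specialisation to the normal form\<close>

lemma sum_telescope_mult:
  fixes P B :: "nat \<Rightarrow> 'a::comm_ring_1"
  shows "(\<Sum>j=1..r. (P j - P (j - 1)) * B j) =
    (\<Sum>j=1..r. (P j - P (j - 1)) * (B j - 1)) + (P r - P 0)"
  by (induction r) (auto simp: algebra_simps)

theorem theorem2p2:
  fixes k r :: nat and \<tau> :: "nat list"
    and m :: "nat \<Rightarrow> nat" and t :: "nat \<Rightarrow> nat list"
  assumes "k \<ge> 2"
    and "\<tau> \<in> Av k {[3, 1, 2]}"
    and "normal_form \<tau> r m t"
  shows
    "(t 0 = [] \<longrightarrow>
        F \<tau> = 1 + var_x * var_q + var_x * (F \<tau> - 1)
          + var_x * var_q * (F (Theta_suffix r m t 1) - 1)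
          + var_x * (\<Sum>j=1..r. (F (Theta_prefix m t j) - F (Theta_prefix m t (j - 1)))
                               * (F (Theta_suffix r m t j) - 1)))
     \<and>
     (t 0 \<noteq> [] \<longrightarrow>
        F \<tau> = 1 + var_x * var_q
          + var_x * (F (t 0) - 1) * of_bool (r = 0)
          + var_x * (F \<tau> - 1) * of_bool (r \<ge> 1)
          + var_x * var_q * (F \<tau> - 1)
          + var_x * (\<Sum>j=2..r. (F (Theta_prefix m t j) - F (Theta_prefix m t (j - 1)))
                               * (F (Theta_suffix r m t j) - 1))
          + var_x * (F (Theta_prefix m t 1) - F (t 0))
              * (F (Theta_suffix r m t 1) - 1) * of_bool (r \<ge> 1)
          + var_x * (F (t 0) - 1) * (F \<tau> - 1))"
proof -
  define bs where "bs = map (\<lambda>l. t l @ [m l]) [0..<Suc r]"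
  have nf: "m j < m (Suc j)" "\<forall>a\<in>set (t j). a < m (Suc j)" if "j < r" for j
    using assms(3) that by (auto simp: normal_form_def)
  have nf': "\<forall>a\<in>set (t j). m j < a" if "j \<le> r" for j
    using assms(3) that by (auto simp: normal_form_def)
  have \<tau>: "\<tau> = concat bs"
    using assms(3) unfolding normal_form_def blocks_def bs_def by blast
  have mono: "m i \<le> m j" if "i \<le> j" "j \<le> r" for i j
    using that
  proof (induction rule: dec_induct)
    case (step l)
    then show ?case using nf(1)[of l] by simp
  qed simp
  have min: "\<forall>w\<in>set bs. ends_with_min w"
    using nf' by (auto simp: bs_def ends_with_min_def)
  have "below (t i @ [m i]) (t j @ [m j])" if "i < j" "j \<le> r" for i j
  proof -
    \<comment> \<open>The normal form compares neighbours only: block \<open>i\<close> lies below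
      \<open>m (Suc i)\<close>, which is at most \<open>m j\<close>, the minimum of block
      \<open>j\<close>.\<close>
    have "x < m (Suc i)" if "x \<in> set (t i @ [m i])" for x
      using that nf[of i] \<open>i < j\<close> \<open>j \<le> r\<close> by auto
    moreover have "m (Suc i) \<le> m j" using mono that by simp
    moreover have "m j \<le> y" if "y \<in> set (t j @ [m j])" for y
      using that nf'[OF \<open>j \<le> r\<close>] by auto
    ultimately show ?thesis unfolding below_def by (meson le_less_trans less_le_trans)
  qed
  then have sorted: "sorted_wrt below bs"
    unfolding bs_def sorted_wrt_map by (simp add: sorted_wrt_iff_nth_less nth_append del: upt_Suc)
  have dist: "distinct (concat bs)" using Av_D(2)[OF assms(2)] \<tau> by simp
  have len: "length bs = Suc r" by (simp add: bs_def)
  define B where "B j = F (concat (drop j bs))" for j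
  have B: "F (Theta_suffix r m t j) = B j" for j
  proof -
    have "blocks m t j r = concat (drop j bs)"
      unfolding blocks_def bs_def by (simp add: drop_map del: upt_Suc)
    moreover have "distinct (concat (drop j bs))"
      using dist by (metis append_take_drop_id concat_append distinct_append)
    ultimately show ?thesis by (simp add: Theta_suffix_def F_reduced B_def)
  qed
  have B0: "B 0 = F \<tau>" by (simp add: B_def \<tau>)
  have front0: "front bs 0 = []" and front1: "front bs 1 = t 0"
    by (simp_all add: front_def bs_def upt_conv_Cons del: upt_Suc)
  have front: "front bs (Suc j) = Theta_prefix m t j" if "1 \<le> j" "j \<le> r" for j
    using that by (simp add: front_def bs_def take_map Theta_prefix_def blocks_def del: upt_Suc)
  have \<Theta>r: "Theta_prefix m t r = \<tau>"
    by (simp add: Theta_prefix_def \<tau> bs_def blocks_def)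
  have ne: "Theta_prefix m t j \<noteq> []" for j
    by (simp add: Theta_prefix_def blocks_def)
  define W where "W i = F (front bs i) + of_bool (front bs i \<noteq> []) * (var_q - 1)" for i
  have W0: "W 0 = 0" by (simp add: W_def front0 F_def)
  have W1: "W 1 = F (t 0) + of_bool (t 0 \<noteq> []) * (var_q - 1)"
    by (simp only: W_def front1)
  \<comment> \<open>The correction \<open>var_q - 1\<close> is the same for all these indices and
    cancels in consecutive differences; it can survive only at the start, depending on whether
    \<open>t 0\<close> is empty.\<close>
  have W: "W (Suc j) = F (Theta_prefix m t j) + (var_q - 1)" if "1 \<le> j" "j \<le> r" for j
    using that by (simp add: W_def front ne)
  have "F \<tau> = 1 + var_x * (\<Sum>i<Suc r. (W (Suc i) - W i) * B i)"
    unfolding \<tau> W_def B_def using F_concat[OF min sorted dist] by (simp add: bs_def)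
  also have "(\<Sum>i<Suc r. (W (Suc i) - W i) * B i) =
      W 1 * B 0 + (\<Sum>i=1..r. (W (Suc i) - W i) * B i)"
    by (simp add: sum.lessThan_Suc_shift sum.atLeast1_atMost_eq W0 del: sum.lessThan_Suc)
  finally have main: "F \<tau> = 1 + var_x * (W 1 * B 0 + (\<Sum>i=1..r. (W (Suc i) - W i) * B i))" .
  have split: "sum g {1..r} = g 1 + sum g {2..r}" if "1 \<le> r" for g :: "nat \<Rightarrow> int poly fps"
    using that by (simp add: sum.atLeast_Suc_atMost numeral_2_eq_2)
  show ?thesis
  proof (intro conjI impI)
    assume t0: "t 0 = []"
    \<comment> \<open>With \<open>t 0 = []\<close> and \<open>r = 0\<close> the pattern would be the
      single letter 1, which \<open>k \<ge> 2\<close> excludes.\<close>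
    have "r \<noteq> 0"
    proof
      assume "r = 0"
      then have "length \<tau> = 1" using t0 by (simp add: \<tau> bs_def)
      then show False using Av_D(1)[OF assms(2)] assms(1) by simp
    qed
    then have r: "1 \<le> r" by simp
    define P where "P j = F (Theta_prefix m t j)" for j
    have P0: "P 0 = 1"
    proof -
      have "m 0 = 1" using assms(3) by (simp add: normal_form_def)
      then have "Theta_prefix m t 0 = [1]" using t0 by (simp add: Theta_prefix_def blocks_def)
      moreover have "reduced [1 :: nat] = [1]"
        by (rule reduced_permutation[of _ 1]) (auto simp: permutations_of_set_def)
      ultimately show ?thesis using perm_gf_1 by (simp add: P_def F_def)
    qed
    have "(\<Sum>i=2..r. (W (Suc i) - W i) * B i) = (\<Sum>i=2..r. (P i - P (i - 1)) * B i)"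
    proof (intro sum.cong refl)
      fix i assume i: "i \<in> {2..r}"
      then obtain l where l: "i = Suc l" "1 \<le> l" by (cases i) auto
      then show "(W (Suc i) - W i) * B i = (P i - P (i - 1)) * B i"
        using i W[of i] W[of l] by (simp add: P_def)
    qed
    \<comment> \<open>Now \<open>front bs 1\<close> is empty, so \<open>W 1 = 0\<close> and the
      correction stays in the coefficient of \<open>B 1\<close>. Its \<open>-1\<close> then serves
      as \<open>- P 0\<close>, because \<open>P 0 = 1\<close>.\<close>
    then have "W 1 * B 0 + (\<Sum>i=1..r. (W (Suc i) - W i) * B i) =
        (P 1 + (var_q - 1)) * B 1 + (\<Sum>i=2..r. (P i - P (i - 1)) * B i)"
      unfolding split[OF r] using W1 W[OF _ r] t0 by (simp add: F_def P_def)
    also have "\<dots> = var_q * B 1 + (\<Sum>i=1..r. (P i - P (i - 1)) * B i)"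
      unfolding split[OF r] by (simp add: P0 algebra_simps)
    \<comment> \<open>Writing \<open>B i\<close> as \<open>(B i - 1) + 1\<close> leaves a
      telescoping sum, equal to \<open>P r - P 0\<close>.\<close>
    finally have "F \<tau> = 1 + var_x * (var_q * B 1 +
        ((\<Sum>i=1..r. (P i - P (i - 1)) * (B i - 1)) + (P r - P 0)))"
      using main unfolding sum_telescope_mult by simp
    also have "P r = F \<tau>" by (simp add: P_def \<Theta>r)
    finally show "F \<tau> = 1 + var_x * var_q + var_x * (F \<tau> - 1)
          + var_x * var_q * (F (Theta_suffix r m t 1) - 1)
          + var_x * (\<Sum>j=1..r. (F (Theta_prefix m t j) - F (Theta_prefix m t (j - 1)))
                               * (F (Theta_suffix r m t j) - 1))"
      unfolding B P_def[symmetric] P0 by (simp add: algebra_simps)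
  next
    assume t0: "t 0 \<noteq> []"
    \<comment> \<open>In case (ii) \<open>t 0\<close> replaces the prefix with index 0, because the
      final 1 of \<open>a 1\<close> can play \<open>m 0\<close>. The correction then occurs in every
      \<open>W (Suc j)\<close> and survives only in the coefficient of \<open>B 0\<close>.\<close>
    define P where "P j = F (if j = 0 then t 0 else Theta_prefix m t j)" for j
    have WP: "W (Suc j) = P j + (var_q - 1)" if "j \<le> r" for j
      using W[of j] W1 that t0 by (cases "j = 0") (simp_all add: P_def)
    have "(\<Sum>i=1..r. (W (Suc i) - W i) * B i) = (\<Sum>i=1..r. (P i - P (i - 1)) * B i)"
    proof (intro sum.cong refl)
      fix i assume i: "i \<in> {1..r}"
      then obtain l where "i = Suc l" by (cases i) auto
      then show "(W (Suc i) - W i) * B i = (P i - P (i - 1)) * B i"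
        using i WP[of i] WP[of l] by simp
    qed
    then have main': "F \<tau> = 1 + var_x * ((P 0 + (var_q - 1)) * F \<tau> +
        ((\<Sum>i=1..r. (P i - P (i - 1)) * (B i - 1)) + (P r - P 0)))"
      using main WP[of 0] unfolding sum_telescope_mult B0 by simp
    have P0: "P 0 = F (t 0)" by (simp add: P_def)
    show "F \<tau> = 1 + var_x * var_q
          + var_x * (F (t 0) - 1) * of_bool (r = 0)
          + var_x * (F \<tau> - 1) * of_bool (r \<ge> 1)
          + var_x * var_q * (F \<tau> - 1)
          + var_x * (\<Sum>j=2..r. (F (Theta_prefix m t j) - F (Theta_prefix m t (j - 1)))
                               * (F (Theta_suffix r m t j) - 1))
          + var_x * (F (Theta_prefix m t 1) - F (t 0))
              * (F (Theta_suffix r m t 1) - 1) * of_bool (r \<ge> 1)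
          + var_x * (F (t 0) - 1) * (F \<tau> - 1)"
    \<comment> \<open>The two cases differ in the boundary term \<open>P r\<close>: it is
      \<open>F (t 0)\<close> for \<open>r = 0\<close> and \<open>F \<tau>\<close> otherwise, which
      accounts for the two delta terms without a product.\<close>
    proof (cases "r = 0")
      case True
      show ?thesis
        by (subst main') (use True P0 in \<open>simp add: algebra_simps\<close>)
    next
      case False
      then have r: "1 \<le> r" by simp
      have Pr: "P r = F \<tau>" using False by (simp add: P_def \<Theta>r)
      define S where "S = (\<Sum>j=2..r. (F (Theta_prefix m t j) - F (Theta_prefix m t (j - 1))) * (B j - 1))"
      have "(\<Sum>i=1..r. (P i - P (i - 1)) * (B i - 1)) =
          (F (Theta_prefix m t 1) - F (t 0)) * (B 1 - 1) + S"
        unfolding split[OF r] S_def by (simp add: P_def)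
      note main'' = main'[unfolded this]
      show ?thesis
        unfolding B S_def[symmetric]
        by (subst main'') (use r P0 Pr in \<open>simp add: algebra_simps\<close>)
    qed
  qed
qed

end
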